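(* For every integer $n\ge0$, $$\sum_{j\ge0}q^{j(j+2)}\begin{bmatrix} n+1\\ 2j+1\end{bmatrix}_{q}=\sum_{k=-\infty}^\infty\left[q^{15k^2+7k}\binom{n+1,\,6k+1;\,q}{6k+1}_2-q^{15k^2+17k+4}\binom{n+1,\,6k+3;\,q}{6k+3}_2\right].$$
   Context: $q$ is an indeterminate. $(a;q)_n=\prod_{i=0}^{n-1}(1-aq^i)$. The Gaussian polynomial is $\begin{bmatrix} A\\ B\end{bmatrix}_{q}=\frac{(q;q)_A}{(q;q)_B(q;q)_{A-B}}$ if $0\le B\le A$, and $0$ otherwise. For integers $L\ge0$, $A$, $B$, the $q$-trinomial coefficient is $$\binom{L,\,B;\,q}{A}_2=\sum_{r\ge0}\frac{q^{r(r+B)}(q;q)_L}{(q;q)_r(q;q)_{r+A}(q;q)_{L-2r-A}}=\sum_{r=0}^L q^{r(r+B)}\begin{bmatrix} L\\ r\end{bmatrix}_{q}\begin{bmatrix} L-r\\ r+A\end{bmatrix}_{q},$$ where terms with a negative subscript in the denominator are zero. All sums have only finitely many nonzero terms. *)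

theory Defs
  imports
    "HOL-Computational_Algebra.Polynomial"
    "HOL-Computational_Algebra.Fraction_Field"
    "HOL-Library.Groups_Big_Fun"
begin

text \<open>
  The indeterminate \<open>q\<close>, as an element of the field of rational functions over an
  arbitrary integral domain. Since \<open>q\<close> is invertible there, negative powers of \<open>q\<close> are
  available through \<open>powi\<close>.
\<close>

definition qvar :: "'a::idom poly fract" where
  "qvar = Fract [:0, 1:] 1"

definition qpoch :: "'a::field \<Rightarrow> 'a \<Rightarrow> nat \<Rightarrow> 'a" where
  "qpoch a q n = (\<Prod>i<n. 1 - a * q ^ i)"

definition gauss_poly :: "int \<Rightarrow> int \<Rightarrow> 'a::field \<Rightarrow> 'a" where
  "gauss_poly A B q =
     (if 0 \<le> B \<and> B \<le> A
      then qpoch q q (nat A) / (qpoch q q (nat B) * qpoch q q (nat (A - B)))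
      else 0)"

text \<open>
  \<open>qtrinomial L B A q\<close> is the \<open>q\<close>-trinomial coefficient with upper entries \<open>L, B; q\<close>,
  lower entry \<open>A\<close> and outer index 2. The range of summation consists of those \<open>r\<close> for which
  no subscript in the denominator is negative; the other terms are zero by convention.
\<close>

definition qtrinomial :: "nat \<Rightarrow> int \<Rightarrow> int \<Rightarrow> 'a::field \<Rightarrow> 'a" where
  "qtrinomial L B A q =
     (\<Sum>r | 0 \<le> int r + A \<and> 0 \<le> int L - 2 * int r - A.
        q powi (int r * (int r + B)) * qpoch q q L /
        (qpoch q q r * qpoch q q (nat (int r + A)) * qpoch q q (nat (int L - 2 * int r - A))))"

lemma qtrinomial_range:
  "{r. 0 \<le> int r + A \<and> 0 \<le> int L - 2 * int r - A} \<subseteq> {..L}"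
  by auto

lemma qpoch_qvar_nonzero: "qpoch qvar (qvar :: 'a::idom poly fract) n \<noteq> 0"
proof -
  have pow: "(qvar :: 'a poly fract) ^ m = Fract (monom 1 m) 1" for m
    by (induction m) (simp_all add: qvar_def One_fract_def monom_Suc)
  have "1 - (qvar :: 'a poly fract) ^ Suc m \<noteq> 0" for m
  proof
    assume "1 - (qvar :: 'a poly fract) ^ Suc m = 0"
    then have "(monom 1 (Suc m) :: 'a poly) = 1"
      unfolding pow by (simp add: One_fract_def Zero_fract_def eq_fract)
    then have "degree (monom (1::'a) (Suc m)) = 0" by simp
    then show False by (simp add: degree_monom_eq)
  qed
  then show ?thesis by (simp add: qpoch_def)
qed

lemma qtrinomial_qvar_altdef:
  "qtrinomial L B A (qvar :: 'a::idom poly fract) =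
     (\<Sum>r=0..L. qvar powi (int r * (int r + B)) *
        gauss_poly (int L) (int r) qvar * gauss_poly (int L - int r) (int r + A) qvar)"
proof -
  have "nat (int L - int r - (int r + A)) = nat (int L - 2 * int r - A)" for r
    by (simp add: algebra_simps)
  moreover have "nat (int L - int r) = L - r" for r
    by simp
  ultimately show ?thesis
    unfolding qtrinomial_def
    by (intro sum.mono_neutral_cong_left)
       (auto simp: gauss_poly_def qpoch_qvar_nonzero field_simps)
qed

text \<open>
  The function \<open>Sum_any\<close> is zero by default on families of infinite support. The following
  facts show that this default never applies to the series of interest.
\<close>

lemma gauss_poly_finite_support:
  "finite {j::nat. c j * gauss_poly (int N) (2 * int j + 1) q \<noteq> 0}"
proof (rule finite_subset)
  show "{j::nat. c j * gauss_poly (int N) (2 * int j + 1) q \<noteq> 0} \<subseteq> {..N}"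
    by (auto simp: gauss_poly_def split: if_splits)
qed simp

lemma qtrinomial_eq_0:
  assumes "int L < \<bar>A\<bar>"
  shows "qtrinomial L B A q = 0"
proof -
  have empty: "{r. 0 \<le> int r + A \<and> 0 \<le> int L - 2 * int r - A} = {}"
    using assms by auto
  show ?thesis
    unfolding qtrinomial_def empty by simp
qed

lemma qtrinomial_finite_support:
  "finite {k::int. c k * qtrinomial L (6 * k + 1) (6 * k + 1) q
                 - d k * qtrinomial L (6 * k + 3) (6 * k + 3) q \<noteq> 0}"
proof (rule finite_subset)
  show "{k::int. c k * qtrinomial L (6 * k + 1) (6 * k + 1) q
               - d k * qtrinomial L (6 * k + 3) (6 * k + 3) q \<noteq> 0} \<subseteq> {- int L - 3 .. int L}"
  proof (rule subsetI, rule ccontr)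
    fix k
    assume *: "k \<in> {k. c k * qtrinomial L (6 * k + 1) (6 * k + 1) q
               - d k * qtrinomial L (6 * k + 3) (6 * k + 3) q \<noteq> 0}"
      and "k \<notin> {- int L - 3 .. int L}"
    then have "int L < \<bar>6 * k + 1\<bar>" "int L < \<bar>6 * k + 3\<bar>"
      by auto
    with * show False
      by (simp add: qtrinomial_eq_0)
  qed
qed simp

end

theory Submission
  imports Defs
begin

text \<open>
  Write \<open>[A, B]\<close> for the Gaussian polynomial and \<open>L = n + 1\<close>. For an odd lower entry
  \<open>2 a + 1\<close>, substituting \<open>r = j - a\<close> in the \<open>q\<close>-trinomial coefficient turns it into
  \<open>\<Sum>j. q^(j (j + 1) - a (a + 1)) [L, 2 j + 1] [2 j + 1, j - a]\<close> (lemma \<open>qtrinomial_odd\<close>).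
  With \<open>a = 3 k\<close> and \<open>a = 3 k + 1\<close> both sides of the theorem become combinations of the
  \<open>[L, 2 j + 1]\<close>, and comparing coefficients leaves an identity free of \<open>L\<close>
  (lemma \<open>cubic_gauss_identity\<close>):
  \<open>\<Sum>k. (q^(6 k^2 + 4 k) [2 j + 1, j - 3 k] - q^(6 k^2 + 8 k + 2) [2 j + 1, j - 3 k - 1]) = q^j\<close>.

  The latter is the case \<open>N = j\<close>, \<open>M = j + 1\<close>, \<open>\<beta> = 2\<close> of
  \<open>F \<beta> N M = \<Sum>i. \<chi> i q^(2 i (i - 1) / 3 + \<beta> i) [N + M, N - i]\<close>,
  where \<open>\<chi> i\<close> is \<open>1, -1, 0\<close> according as \<open>i\<close> is \<open>0, 1, 2\<close> modulo 3
  (the constant \<open>cubic_sum\<close> below). These sums are closed under the two \<open>q\<close>-Pascal rules: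
  the power of \<open>q\<close> in a Pascal rule depends on \<open>i\<close> only through \<open>q^i\<close> or \<open>q^(-i)\<close>, so
  it merely moves \<open>\<beta>\<close> by one. Moreover \<open>F\<close> vanishes on two walls, since there
  \<open>i \<mapsto> N - M - i\<close> preserves the exponents and the Gaussian polynomials but reverses the
  sign \<open>\<chi>\<close>: \<open>F 0 (N + 1) N = 0\<close> and \<open>F 2 N (N + 2) = 0\<close>. In each Pascal step that is
  needed, one of the two terms lies on a wall, whence
  \<open>F 1 N N = F 1 (N - 1) N = F 1 (N - 1) (N - 1) = \<dots> = 1\<close>, and one more step gives
  \<open>F 2 j (j + 1) = q^j F 1 j j = q^j\<close>.
\<close>

section \<open>Pascal rules for Gaussian polynomials\<close>

text \<open>
  The argument works at every element of a field that is neither zero nor a root of unity; the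
  condition on \<open>qpoch\<close> expresses the latter.
\<close>

context
  fixes q :: "'a::field"
  assumes q_nonzero: "q \<noteq> 0"
    and qpoch_nonzero: "\<And>n. qpoch q q n \<noteq> 0"
begin

lemma qpoch_Suc: "qpoch q q (Suc n) = qpoch q q n * (1 - q ^ Suc n)"
  by (simp add: qpoch_def)

lemma one_minus_power_nonzero: "1 - q ^ Suc n \<noteq> 0"
  using qpoch_nonzero[of "Suc n"] unfolding qpoch_Suc by (simp del: power_Suc)

lemma gauss_poly_eq_0: "B < 0 \<or> A < B \<Longrightarrow> gauss_poly A B q = 0"
  by (auto simp: gauss_poly_def)

lemma gauss_poly_symmetric: "gauss_poly A (A - B) q = gauss_poly A B q"
  by (simp add: gauss_poly_def mult.commute)

text \<open>
  The restriction \<open>A \<ge> 1\<close> matters: at \<open>A = 0\<close>, \<open>B = 0\<close> the left-hand side is 1 and the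
  right-hand side is 0.
\<close>

lemma gauss_poly_pascal:
  assumes "A \<ge> 1"
  shows "gauss_poly A B q = gauss_poly (A - 1) B q + q powi (A - B) * gauss_poly (A - 1) (B - 1) q"
proof (cases "0 < B \<and> B < A")
  case True
  define b where "b = nat (B - 1)"
  define c where "c = nat (A - B - 1)"
  have B: "B = int b + 1" and A: "A = int b + int c + 2"
    using True by (auto simp: b_def c_def)
  have nats: "nat A = Suc (Suc (b + c))" "nat B = Suc b" "nat (A - B) = Suc c"
      "nat (A - 1) = Suc (b + c)" "nat (B - 1) = b" "nat (A - 1 - B) = c" "nat (A - 1 - (B - 1)) = Suc c"
    by (auto simp: A B)
  have pw: "q powi (A - B) = q ^ Suc c"
    using True nats(3) by (simp add: power_int_def)
  define x where "x = q ^ Suc b"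
  define y where "y = q ^ Suc c"
  have xy: "q ^ Suc (Suc (b + c)) = x * y"
    by (simp add: x_def y_def power_add)
  define P where "P = qpoch q q (Suc (b + c))"
  define Qb where "Qb = qpoch q q b"
  define Qc where "Qc = qpoch q q c"
  have nz: "1 - x \<noteq> 0" "1 - y \<noteq> 0" "Qb \<noteq> 0" "Qc \<noteq> 0"
    using one_minus_power_nonzero qpoch_nonzero unfolding x_def y_def Qb_def Qc_def by auto
  have "P * (1 - x * y) / ((Qb * (1 - x)) * (Qc * (1 - y)))
      = P / ((Qb * (1 - x)) * Qc) + y * (P / (Qb * (Qc * (1 - y))))"
    using nz by (simp add: divide_simps) (simp add: algebra_simps)
  moreover have "gauss_poly A B q = P * (1 - x * y) / ((Qb * (1 - x)) * (Qc * (1 - y)))"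
    using True unfolding gauss_poly_def nats qpoch_Suc[of "Suc (b + c)"] qpoch_Suc[of b] qpoch_Suc[of c]
    by (simp add: P_def Qb_def Qc_def x_def[symmetric] y_def[symmetric] xy del: power_Suc)
  moreover have "gauss_poly (A - 1) B q = P / ((Qb * (1 - x)) * Qc)"
    using True unfolding gauss_poly_def nats qpoch_Suc[of b]
    by (simp add: P_def Qb_def Qc_def x_def[symmetric] del: power_Suc)
  moreover have "gauss_poly (A - 1) (B - 1) q = P / (Qb * (Qc * (1 - y)))"
    using True unfolding gauss_poly_def nats qpoch_Suc[of c]
    by (simp add: P_def Qb_def Qc_def y_def[symmetric] del: power_Suc)
  ultimately show ?thesis
    by (simp add: pw y_def)
next
  case False
  have "qpoch q q 0 = 1" by (simp add: qpoch_def)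
  then show ?thesis
    using False assms qpoch_nonzero by (cases "B = 0 \<or> B = A") (auto simp: gauss_poly_def)
qed

lemma gauss_poly_pascal':
  assumes "A \<ge> 1"
  shows "gauss_poly A B q = gauss_poly (A - 1) (B - 1) q + q powi B * gauss_poly (A - 1) B q"
  using gauss_poly_pascal[OF assms, of "A - B"]
    gauss_poly_symmetric[of "A - 1" "B - 1"] gauss_poly_symmetric[of "A - 1" B]
    gauss_poly_symmetric[of A B]
  by (simp add: algebra_simps)

section \<open>Weighted sums of Gaussian polynomials\<close>

text \<open>
  The interval contains every \<open>i\<close> with a nonzero Gaussian polynomial, so this is the sum over
  all integers. It is also stable under the reflection \<open>i \<mapsto> N - M - i\<close>. Keeping the factor
  \<open>q powi (\<beta> * i)\<close> apart from the weight makes the Pascal rules hold for arbitrary \<open>h\<close>.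
\<close>

definition gauss_sum :: "(int \<Rightarrow> 'a) \<Rightarrow> int \<Rightarrow> int \<Rightarrow> int \<Rightarrow> 'a" where
  "gauss_sum h \<beta> N M = (\<Sum>i = -M..N. h i * q powi (\<beta> * i) * gauss_poly (N + M) (N - i) q)"

lemma gauss_sum_superset:
  assumes "finite I" "{-M..N} \<subseteq> I"
  shows "gauss_sum h \<beta> N M = (\<Sum>i\<in>I. h i * q powi (\<beta> * i) * gauss_poly (N + M) (N - i) q)"
  unfolding gauss_sum_def using assms
  by (intro sum.mono_neutral_left) (auto intro!: gauss_poly_eq_0)

lemma gauss_sum_pascal:
  assumes "N + M \<ge> 1"
  shows "gauss_sum h \<beta> N M = gauss_sum h \<beta> N (M - 1) + q powi M * gauss_sum h (\<beta> + 1) (N - 1) M"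
proof -
  have "h i * q powi (\<beta> * i) * gauss_poly (N + M) (N - i) q
      = h i * q powi (\<beta> * i) * gauss_poly (N + (M - 1)) (N - i) q
      + q powi M * (h i * q powi ((\<beta> + 1) * i) * gauss_poly (N - 1 + M) (N - 1 - i) q)" for i
  proof -
    have args: "N + (M - 1) = N + M - 1" "N - 1 + M = N + M - 1" "N - 1 - i = N - i - 1"
        "N + M - (N - i) = M + i" "(\<beta> + 1) * i = \<beta> * i + i"
      by (simp_all add: algebra_simps)
    show ?thesis
      unfolding gauss_poly_pascal[OF assms, of "N - i"] args
      by (simp only: power_int_add q_nonzero simp_thms) (simp add: distrib_left mult_ac)
  qed
  then show ?thesis
    by (simp add: gauss_sum_superset[of "{-M..N}"] sum.distrib sum_distrib_left)
qed

lemma gauss_sum_pascal':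
  assumes "N + M \<ge> 1"
  shows "gauss_sum h \<beta> N M = gauss_sum h \<beta> (N - 1) M + q powi N * gauss_sum h (\<beta> - 1) N (M - 1)"
proof -
  have "h i * q powi (\<beta> * i) * gauss_poly (N + M) (N - i) q
      = h i * q powi (\<beta> * i) * gauss_poly (N - 1 + M) (N - 1 - i) q
      + q powi N * (h i * q powi ((\<beta> - 1) * i) * gauss_poly (N + (M - 1)) (N - i) q)" for i
  proof -
    have args: "N + (M - 1) = N + M - 1" "N - 1 + M = N + M - 1" "N - 1 - i = N - i - 1"
      by simp_all
    have "q powi (\<beta> * i) * q powi (N - i) = q powi N * q powi ((\<beta> - 1) * i)"
      by (simp add: power_int_add[symmetric] q_nonzero algebra_simps)
    then have "h i * q powi (\<beta> * i) * (q powi (N - i) * x)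
        = q powi N * (h i * q powi ((\<beta> - 1) * i) * x)" for x
      by (simp add: mult.assoc[symmetric])
    then show ?thesis
      unfolding gauss_poly_pascal'[OF assms, of "N - i"] args distrib_left by simp
  qed
  then show ?thesis
    by (simp add: gauss_sum_superset[of "{-M..N}"] sum.distrib sum_distrib_left)
qed

text \<open>
  The reflection exchanges the lower entries \<open>N - i\<close> and \<open>M + i\<close>, which are complementary
  in \<open>N + M\<close>.
\<close>

lemma gauss_sum_reflect:
  assumes "\<And>i. g (N - M - i) * q powi (\<beta> * (N - M - i)) = h i * q powi (\<beta> * i)"
  shows "gauss_sum g \<beta> N M = gauss_sum h \<beta> N M"
  unfolding gauss_sum_def
proof (rule sum.reindex_bij_witness[where i = "\<lambda>i. N - M - i" and j = "\<lambda>i. N - M - i"])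
  fix i
  have "gauss_poly (N + M) (N - (N - M - i)) q = gauss_poly (N + M) (N - i) q"
    using gauss_poly_symmetric[of "N + M" "N - i"] by (simp add: algebra_simps)
  then show "h (N - M - i) * q powi (\<beta> * (N - M - i)) * gauss_poly (N + M) (N - (N - M - i)) q
      = g i * q powi (\<beta> * i) * gauss_poly (N + M) (N - i) q"
    using assms[of "N - M - i"] by simp
qed auto

section \<open>The cubic sum\<close>

text \<open>
  Used for \<open>c \<in> {0, 1}\<close>, where the division by 3 is exact.
\<close>

definition residue_weight :: "int \<Rightarrow> int \<Rightarrow> 'a" where
  "residue_weight c i = (if i mod 3 = c then q powi (2 * i * (i - 1) div 3) else 0)"

definition cubic_sum :: "int \<Rightarrow> int \<Rightarrow> int \<Rightarrow> 'a" where
  "cubic_sum \<beta> N M = gauss_sum (residue_weight 0) \<beta> N M - gauss_sum (residue_weight 1) \<beta> N M"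

lemma cubic_sum_pascal:
  "N + M \<ge> 1 \<Longrightarrow>
    cubic_sum \<beta> N M = cubic_sum \<beta> N (M - 1) + q powi M * cubic_sum (\<beta> + 1) (N - 1) M"
  by (simp add: cubic_sum_def gauss_sum_pascal[of N M] algebra_simps)

lemma cubic_sum_pascal':
  "N + M \<ge> 1 \<Longrightarrow>
    cubic_sum \<beta> N M = cubic_sum \<beta> (N - 1) M + q powi N * cubic_sum (\<beta> - 1) N (M - 1)"
  by (simp add: cubic_sum_def gauss_sum_pascal'[of N M] algebra_simps)

text \<open>
  The reflection \<open>i \<mapsto> 1 - i\<close> preserves \<open>i (i - 1)\<close> and exchanges the residues 0 and 1. Showing
  that it exchanges the two parts of the sum, instead of that the sum equals its own negative,
  keeps the argument valid in characteristic 2.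
\<close>

lemma cubic_sum_upper_wall: "cubic_sum 0 (N + 1) N = 0"
proof -
  have "residue_weight 0 (1 - i) = residue_weight 1 i" for i
  proof -
    have "(1 - i) mod 3 = 0 \<longleftrightarrow> i mod 3 = 1" by presburger
    moreover have "2 * (1 - i) * (1 - i - 1) = 2 * i * (i - 1)" by (simp add: algebra_simps)
    ultimately show ?thesis by (simp add: residue_weight_def)
  qed
  then show ?thesis
    unfolding cubic_sum_def by (subst gauss_sum_reflect[where h = "residue_weight 1"]) auto
qed

text \<open>
  For \<open>\<beta> = 2\<close> the total exponent is \<open>2 i (i + 2) / 3\<close>, which is invariant under
  \<open>i \<mapsto> - 2 - i\<close>; this reflection exchanges the residues 0 and 1 as well.
\<close>

lemma cubic_sum_lower_wall: "cubic_sum 2 N (N + 2) = 0"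
proof -
  have "residue_weight 0 (- 2 - i) * q powi (2 * (- 2 - i)) = residue_weight 1 i * q powi (2 * i)" for i
  proof (cases "i mod 3 = 1")
    case True
    define k where "k = i div 3"
    have i: "i = 3 * k + 1" using True unfolding k_def by presburger
    have m: "(- 2 - i) mod 3 = 0" using True by presburger
    have "2 * (- 2 - i) * (- 2 - i - 1) = 3 * (2 * (k + 1) * (3 * k + 4))"
      by (simp add: i algebra_simps)
    then have d: "2 * (- 2 - i) * (- 2 - i - 1) div 3 = 2 * (k + 1) * (3 * k + 4)"
      by (simp only: nonzero_mult_div_cancel_left)
    have "2 * i * (i - 1) = 3 * (2 * (3 * k + 1) * k)"
      by (simp add: i algebra_simps)
    then have d': "2 * i * (i - 1) div 3 = 2 * (3 * k + 1) * k"
      by (simp only: nonzero_mult_div_cancel_left)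
    have e: "2 * (k + 1) * (3 * k + 4) + 2 * (- 2 - i) = 2 * (3 * k + 1) * k + 2 * i"
      by (simp add: i algebra_simps)
    show ?thesis
      unfolding residue_weight_def d d' if_P[OF m] if_P[OF True]
      by (simp only: power_int_add[symmetric] q_nonzero e simp_thms)
  next
    case False
    then have "(- 2 - i) mod 3 \<noteq> 0" by presburger
    with False show ?thesis by (simp add: residue_weight_def)
  qed
  then show ?thesis
    unfolding cubic_sum_def by (subst gauss_sum_reflect[where h = "residue_weight 1"]) auto
qed

text \<open>
  Descending from \<open>(n + 1, n + 1)\<close> to \<open>(n, n + 1)\<close> and then to \<open>(n, n)\<close>, the unwanted term of
  the first step is on the upper wall and that of the second on the lower wall.
\<close>

lemma cubic_sum_diagonal: "cubic_sum 1 (int n) (int n) = 1"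
proof (induction n)
  case 0
  show ?case
    by (simp add: cubic_sum_def gauss_sum_def residue_weight_def gauss_poly_def qpoch_def)
next
  case (Suc n)
  have "cubic_sum 1 (int n + 1) (int n + 1)
      = cubic_sum 1 (int n) (int n + 1) + q powi (int n + 1) * cubic_sum 0 (int n + 1) (int n)"
    by (subst cubic_sum_pascal') auto
  also have "\<dots> = cubic_sum 1 (int n) (int n + 1)"
    by (simp add: cubic_sum_upper_wall)
  also have "\<dots> = cubic_sum 1 (int n) (int n)
      + q powi (int n + 1) * cubic_sum 2 (int n - 1) (int n - 1 + 2)"
    by (subst cubic_sum_pascal) (auto simp: algebra_simps)
  also have "\<dots> = 1"
    unfolding cubic_sum_lower_wall by (simp add: Suc.IH)
  finally show ?case by (simp add: add.commute)
qed

lemma cubic_sum_near_diagonal: "cubic_sum 2 (int j) (int j + 1) = q ^ j"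
proof -
  have "cubic_sum 2 (int j) (int j + 1)
      = cubic_sum 2 (int j - 1) (int j - 1 + 2) + q powi int j * cubic_sum 1 (int j) (int j)"
    by (subst cubic_sum_pascal') (auto simp: algebra_simps)
  then show ?thesis
    unfolding cubic_sum_lower_wall by (simp add: cubic_sum_diagonal)
qed

section \<open>The identity free of \<open>L\<close>\<close>

text \<open>
  Passage from the summation index \<open>i = 3 k + c\<close> to \<open>k\<close>. The range of \<open>k\<close> only has to be large
  enough; leaving \<open>K\<close> free provides a common range for all the sums over \<open>k\<close> that are combined
  later.
\<close>

lemma gauss_sum_residue:
  assumes "\<bar>N\<bar> \<le> K" "\<bar>M\<bar> \<le> K" "c \<in> {0, 1}"
    and e: "\<And>k. e k = 2 * (3 * k + c) * (3 * k + c - 1) div 3 + \<beta> * (3 * k + c)"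
  shows "gauss_sum (residue_weight c) \<beta> N M
    = (\<Sum>k = -K-1..K. q powi (e k) * gauss_poly (N + M) (N - (3 * k + c)) q)"
proof -
  let ?f = "\<lambda>i. residue_weight c i * q powi (\<beta> * i) * gauss_poly (N + M) (N - i) q"
  have "gauss_sum (residue_weight c) \<beta> N M = (\<Sum>i = -3*K-3..3*K+2. ?f i)"
    using assms by (intro gauss_sum_superset) auto
  also have "\<dots> = (\<Sum>i | i \<in> {-3*K-3..3*K+2} \<and> i mod 3 = c. ?f i)"
    by (rule sum.mono_neutral_right) (auto simp: residue_weight_def)
  also have "\<dots> = (\<Sum>k = -K-1..K. q powi (e k) * gauss_poly (N + M) (N - (3 * k + c)) q)"
  proof (rule sum.reindex_bij_witness[where i = "\<lambda>k. 3 * k + c" and j = "\<lambda>i. i div 3"])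
    fix i assume i: "i \<in> {i \<in> {-3*K-3..3*K+2}. i mod 3 = c}"
    then have m: "i mod 3 = c" by simp
    then show *: "3 * (i div 3) + c = i" by auto
    show "i div 3 \<in> {-K-1..K}" using i by auto
    show "q powi (e (i div 3)) * gauss_poly (N + M) (N - (3 * (i div 3) + c)) q = ?f i"
      unfolding e * using m by (simp add: residue_weight_def power_int_add q_nonzero)
  qed (use assms in auto)
  finally show ?thesis .
qed

lemma cubic_gauss_identity:
  assumes "int j < K"
  shows "(\<Sum>k = -K-1..K. q powi (6 * k^2 + 4 * k) * gauss_poly (2 * int j + 1) (int j - 3 * k) q
      - q powi (6 * k^2 + 8 * k + 2) * gauss_poly (2 * int j + 1) (int j - (3 * k + 1)) q) = q ^ j"
proof -
  have d: "2 * (3 * k + 0) * (3 * k + 0 - 1) div 3 = 2 * k * (3 * k - 1)"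
    "2 * (3 * k + 1) * (3 * k + 1 - 1) div 3 = 2 * (3 * k + 1) * k" for k :: int
  proof -
    have "2 * (3 * k + 0) * (3 * k + 0 - 1) = 3 * (2 * k * (3 * k - 1))"
      "2 * (3 * k + 1) * (3 * k + 1 - 1) = 3 * (2 * (3 * k + 1) * k)" 
      by (simp_all add: algebra_simps)
    then show "2 * (3 * k + 0) * (3 * k + 0 - 1) div 3 = 2 * k * (3 * k - 1)"
      "2 * (3 * k + 1) * (3 * k + 1 - 1) div 3 = 2 * (3 * k + 1) * k"
      by (simp_all only: nonzero_mult_div_cancel_left)
  qed
  have e0: "6 * k^2 + 4 * k = 2 * (3 * k + 0) * (3 * k + 0 - 1) div 3 + 2 * (3 * k + 0)" for k :: int
    unfolding d by (simp add: power2_eq_square algebra_simps)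
  have e1: "6 * k^2 + 8 * k + 2 = 2 * (3 * k + 1) * (3 * k + 1 - 1) div 3 + 2 * (3 * k + 1)" for k :: int
    unfolding d by (simp add: power2_eq_square algebra_simps)
  have "cubic_sum 2 (int j) (int j + 1) =
    (\<Sum>k = -K-1..K. q powi (6 * k^2 + 4 * k) * gauss_poly (int j + (int j + 1)) (int j - (3 * k + 0)) q)
    - (\<Sum>k = -K-1..K. q powi (6 * k^2 + 8 * k + 2) * gauss_poly (int j + (int j + 1)) (int j - (3 * k + 1)) q)"
    unfolding cubic_sum_def
    by (subst (1 2) gauss_sum_residue[of _ K]) (use assms e0 e1 in auto)
  moreover have "int j + (int j + 1) = 2 * int j + 1" by simp
  ultimately show ?thesis
    by (simp add: cubic_sum_near_diagonal sum_subtractf)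
qed

section \<open>Expansion of the trinomial coefficients\<close>

text \<open>
  With \<open>r = j - a\<close> the exponent \<open>r (r + 2 a + 1)\<close> is \<open>j (j + 1) - a (a + 1)\<close>, and since
  \<open>r + (r + 2 a + 1) = 2 j + 1\<close> the multinomial quotient factors through \<open>[L, 2 j + 1]\<close>.
\<close>

lemma qtrinomial_odd:
  "qtrinomial L (2 * a + 1) (2 * a + 1) q =
    (\<Sum>j\<le>L. q powi (int j * (int j + 1) - a * (a + 1)) * gauss_poly (int L) (2 * int j + 1) q
      * gauss_poly (2 * int j + 1) (int j - a) q)"
proof -
  let ?J = "{j. a \<le> int j \<and> 0 \<le> int j + a + 1 \<and> 2 * int j + 1 \<le> int L}"
  let ?g = "\<lambda>j. q powi (int j * (int j + 1) - a * (a + 1)) * gauss_poly (int L) (2 * int j + 1) q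
      * gauss_poly (2 * int j + 1) (int j - a) q"
  have "qtrinomial L (2 * a + 1) (2 * a + 1) q = (\<Sum>j\<in>?J. ?g j)"
    unfolding qtrinomial_def
  proof (rule sum.reindex_bij_witness[where i = "\<lambda>j. nat (int j - a)" and j = "\<lambda>r. nat (int r + a)"])
    fix r
    assume r: "r \<in> {r. 0 \<le> int r + (2 * a + 1) \<and> 0 \<le> int L - 2 * int r - (2 * a + 1)}"
    define j where "j = nat (int r + a)"
    have j: "int j = int r + a" using r by (auto simp: j_def)
    show "nat (int (nat (int r + a)) - a) = r" using r by auto
    show "nat (int r + a) \<in> ?J" using r by auto
    have conds: "0 \<le> 2 * int j + 1 \<and> 2 * int j + 1 \<le> int L" "0 \<le> int j - a \<and> int j - a \<le> 2 * int j + 1"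
      using r by (auto simp: j)
    have nats: "nat (int L) = L" "nat (int j - a) = r" "nat (2 * int j + 1 - (int j - a)) = nat (int r + (2 * a + 1))"
      "nat (int L - (2 * int j + 1)) = nat (int L - 2 * int r - (2 * a + 1))"
      by (auto simp: j algebra_simps)
    have e: "int j * (int j + 1) - a * (a + 1) = int r * (int r + (2 * a + 1))"
      by (simp add: j algebra_simps)
    show "?g (nat (int r + a)) = q powi (int r * (int r + (2 * a + 1))) * qpoch q q L /
        (qpoch q q r * qpoch q q (nat (int r + (2 * a + 1))) * qpoch q q (nat (int L - 2 * int r - (2 * a + 1))))"
      unfolding j_def[symmetric] e gauss_poly_def if_P[OF conds(1)] if_P[OF conds(2)] nats
      using qpoch_nonzero by (simp add: field_simps)
  qed auto
  also have "\<dots> = (\<Sum>j\<le>L. ?g j)"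
  proof (rule sum.mono_neutral_left)
    show "\<forall>j\<in>{..L} - ?J. ?g j = 0"
    proof
      fix j assume "j \<in> {..L} - ?J"
      then consider "int j - a < 0" | "2 * int j + 1 < int j - a" | "int L < 2 * int j + 1"
        by force
      then show "?g j = 0"
        by cases (simp_all add: gauss_poly_eq_0)
    qed
  qed auto
  finally show ?thesis .
qed

text \<open>
  After interchanging the summations, the inner sum over \<open>k\<close> is the one evaluated by
  \<open>cubic_gauss_identity\<close>.
\<close>

lemma gauss_sum_eq_qtrinomial_sum:
  "(\<Sum>j\<le>L. q ^ (j * (j + 2)) * gauss_poly (int L) (2 * int j + 1) q) =
    (\<Sum>k = -int L-2..int L+1.
        q powi (15 * k^2 + 7 * k) * qtrinomial L (6 * k + 1) (6 * k + 1) q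
      - q powi (15 * k^2 + 17 * k + 4) * qtrinomial L (6 * k + 3) (6 * k + 3) q)"
proof -
  define G where "G j = q ^ (j * (j + 1)) * gauss_poly (int L) (2 * int j + 1) q" for j
  define t where "t j k = q powi (6 * k^2 + 4 * k) * gauss_poly (2 * int j + 1) (int j - 3 * k) q
      - q powi (6 * k^2 + 8 * k + 2) * gauss_poly (2 * int j + 1) (int j - (3 * k + 1)) q" for j k
  have summand: "q powi (15 * k^2 + 7 * k) * qtrinomial L (6 * k + 1) (6 * k + 1) q
      - q powi (15 * k^2 + 17 * k + 4) * qtrinomial L (6 * k + 3) (6 * k + 3) q
      = (\<Sum>j\<le>L. G j * t j k)" for k
  proof -
    have p: "q powi e * (q powi (int j * (int j + 1) - d) * x * y)
        = q ^ (j * (j + 1)) * x * (q powi (e - d) * y)" for e d x y j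
    proof -
      have "q powi e * q powi (int j * (int j + 1) - d) = q powi (int (j * (j + 1)) + (e - d))"
        by (simp add: power_int_add[symmetric] q_nonzero algebra_simps)
      also have "\<dots> = q ^ (j * (j + 1)) * q powi (e - d)"
        by (simp only: power_int_add q_nonzero power_int_of_nat simp_thms)
      finally show ?thesis by (simp add: mult_ac)
    qed
    have e: "15 * k^2 + 7 * k - 3 * k * (3 * k + 1) = 6 * k^2 + 4 * k"
      "15 * k^2 + 17 * k + 4 - (3 * k + 1) * (3 * k + 1 + 1) = 6 * k^2 + 8 * k + 2"
      by (simp_all add: power2_eq_square algebra_simps)
    have A: "6 * k + 1 = 2 * (3 * k) + 1" "6 * k + 3 = 2 * (3 * k + 1) + 1" by simp_all
    show ?thesis
      unfolding A qtrinomial_odd sum_distrib_left p e G_def t_def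
      by (simp only: sum_subtractf right_diff_distrib)
  qed
  have "(\<Sum>k = -int L-2..int L+1. \<Sum>j\<le>L. G j * t j k)
      = (\<Sum>j\<le>L. G j * (\<Sum>k = -(int L + 1)-1..int L+1. t j k))"
    by (subst sum.swap) (simp add: sum_distrib_left algebra_simps)
  also have "\<dots> = (\<Sum>j\<le>L. G j * q ^ j)"
    unfolding t_def by (intro sum.cong refl, subst cubic_gauss_identity) auto
  also have "\<dots> = (\<Sum>j\<le>L. q ^ (j * (j + 2)) * gauss_poly (int L) (2 * int j + 1) q)"
    by (intro sum.cong) (simp_all add: G_def algebra_simps power_add)
  finally show ?thesis
    unfolding summand by simp
qed

end

theorem mainTheorem19:
  fixes n :: nat
  shows "Sum_any (\<lambda>j::nat. qvar ^ (j * (j + 2)) * gauss_poly (int n + 1) (2 * int j + 1) qvar) =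
    (Sum_any (\<lambda>k::int.
        qvar powi (15 * k^2 + 7 * k) * qtrinomial (n + 1) (6 * k + 1) (6 * k + 1) qvar
      - qvar powi (15 * k^2 + 17 * k + 4) * qtrinomial (n + 1) (6 * k + 3) (6 * k + 3) qvar)
      :: 'a::idom poly fract)"
    (is "?lhs = ?rhs")
proof -
  have qvar_nonzero: "(qvar :: 'a poly fract) \<noteq> 0"
    by (simp add: qvar_def Zero_fract_def eq_fract)
  have "?lhs = (\<Sum>j\<le>n+1. qvar ^ (j * (j + 2)) * gauss_poly (int (n + 1)) (2 * int j + 1) qvar)"
    by (subst Sum_any.expand_superset[of "{..n+1}"])
      (auto simp: gauss_poly_def add.commute split: if_splits)
  also have "\<dots> = (\<Sum>k = -int (n+1)-2..int (n+1)+1.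
        qvar powi (15 * k^2 + 7 * k) * qtrinomial (n + 1) (6 * k + 1) (6 * k + 1) qvar
      - qvar powi (15 * k^2 + 17 * k + 4) * qtrinomial (n + 1) (6 * k + 3) (6 * k + 3) qvar)"
    by (rule gauss_sum_eq_qtrinomial_sum[OF qvar_nonzero qpoch_qvar_nonzero])
  also have "\<dots> = ?rhs"
  proof (rule Sum_any.expand_superset[symmetric])
    show "{k. qvar powi (15 * k^2 + 7 * k) * qtrinomial (n + 1) (6 * k + 1) (6 * k + 1) qvar
      - qvar powi (15 * k^2 + 17 * k + 4) * qtrinomial (n + 1) (6 * k + 3) (6 * k + 3) qvar
      \<noteq> (0 :: 'a poly fract)} \<subseteq> {-int (n+1)-2..int (n+1)+1}"
    proof (rule subsetI, rule ccontr)
      fix k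
      assume *: "k \<in> {k. qvar powi (15 * k^2 + 7 * k) * qtrinomial (n + 1) (6 * k + 1) (6 * k + 1) qvar
        - qvar powi (15 * k^2 + 17 * k + 4) * qtrinomial (n + 1) (6 * k + 3) (6 * k + 3) qvar
        \<noteq> (0 :: 'a poly fract)}" and "k \<notin> {-int (n+1)-2..int (n+1)+1}"
      then have "int (n + 1) < \<bar>6 * k + 1\<bar>" "int (n + 1) < \<bar>6 * k + 3\<bar>"
        by auto
      with * show False
        by (simp add: qtrinomial_eq_0)
    qed
  qed simp
  finally show ?thesis .
qed

end
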